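(* Let $G$ be a connected cograph that is not complete. Then for every optimal treedepth decomposition $T$ of $G$, $|ts(T)| \le tw(G)$.
   Context: A graph is a cograph if it has no induced subgraph isomorphic to the path on $4$ vertices. A treedepth decomposition of a connected graph $G$ is a rooted tree $T$ with $V(T)=V(G)$ such that for every edge $uv$ of $G$, one of $u,v$ is an ancestor of the other in $T$; its height is the maximum number of vertices on a root-to-leaf path; $td(G)$ is the minimum height over all treedepth decompositions, and $T$ is optimal if its height equals $td(G)$. The top separator $ts(T)$: if every vertex of $T$ has at most one child, $ts(T):=V(T)$; otherwise let $p$ be the vertex of smallest depth having more than one child, and $ts(T)$ is the set of vertices on the path from the root to $p$, inclusive. The treewidth $tw(G)$ is the minimum, over all tree decompositions of $G$, of the maximum bag size minus one. *)

theory Defs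
  imports "Graph_Theory.Graph_Theory"
begin

text \<open>
  Finite simple graphs are modelled by the locale \<^locale>\<open>pair_graph\<close>: finite, loop-free, symmetric
  digraphs whose arcs are ordered pairs of vertices, so that an edge is a pair of opposite arcs.
  The predicate \<^const>\<open>Digraph_Component.connected\<close> entails that the graph has a vertex.
\<close>


section \<open>Cographs\<close>

definition path_graph :: "nat \<Rightarrow> nat pair_pre_digraph" where
  "path_graph n = \<lparr> pverts = {..<n},
     parcs = {(i, j). i < n \<and> j < n \<and> (j = Suc i \<or> i = Suc j)} \<rparr>"

definition cograph :: "'a pair_pre_digraph \<Rightarrow> bool" where
  "cograph G \<longleftrightarrow> \<not> (\<exists>H. induced_subgraph H (with_proj G) \<and>
     digraph_iso H (with_proj (path_graph 4)))"


section \<open>Rooted trees\<close>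

text \<open>
  A rooted tree is given by its parent-to-child arcs together with its root \<open>r\<close>. Hence \<open>u\<close> is an
  ancestor of \<open>v\<close> (or \<open>v\<close> itself) iff \<open>v\<close> is reachable from \<open>u\<close>.
\<close>

definition rooted_tree :: "'a pair_pre_digraph \<Rightarrow> 'a \<Rightarrow> bool" where
  "rooted_tree T r \<longleftrightarrow> pair_wf_digraph T \<and> r \<in> pverts T \<and>
     (\<forall>v \<in> pverts T. \<exists>!p. pre_digraph.awalk (with_proj T) r p v)"

definition children :: "'a pair_pre_digraph \<Rightarrow> 'a \<Rightarrow> 'a set" where
  "children T v = {w. (v, w) \<in> parcs T}"

definition leaf :: "'a pair_pre_digraph \<Rightarrow> 'a \<Rightarrow> bool" where
  "leaf T v \<longleftrightarrow> v \<in> pverts T \<and> children T v = {}"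

text \<open>The vertices on the path from the root to \<open>v\<close>, both ends included.\<close>

definition root_path :: "'a pair_pre_digraph \<Rightarrow> 'a \<Rightarrow> 'a \<Rightarrow> 'a set" where
  "root_path T r v = set (pawalk_verts r (THE p. pre_digraph.awalk (with_proj T) r p v))"

definition depth :: "'a pair_pre_digraph \<Rightarrow> 'a \<Rightarrow> 'a \<Rightarrow> nat" where
  "depth T r v = card (root_path T r v)"

definition height :: "'a pair_pre_digraph \<Rightarrow> 'a \<Rightarrow> nat" where
  "height T r = Max {depth T r v |v. leaf T v}"


section \<open>Treedepth\<close>

definition treedepth_decomposition ::
    "'a pair_pre_digraph \<Rightarrow> 'a pair_pre_digraph \<Rightarrow> 'a \<Rightarrow> bool" where
  "treedepth_decomposition G T r \<longleftrightarrow> rooted_tree T r \<and> pverts T = pverts G \<and>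
     (\<forall>(u, v) \<in> parcs G. u \<rightarrow>\<^sup>*\<^bsub>with_proj T\<^esub> v \<or> v \<rightarrow>\<^sup>*\<^bsub>with_proj T\<^esub> u)"

definition treedepth :: "'a pair_pre_digraph \<Rightarrow> nat" where
  "treedepth G = (LEAST h. \<exists>T r. treedepth_decomposition G T r \<and> height T r = h)"

definition optimal_treedepth_decomposition ::
    "'a pair_pre_digraph \<Rightarrow> 'a pair_pre_digraph \<Rightarrow> 'a \<Rightarrow> bool" where
  "optimal_treedepth_decomposition G T r \<longleftrightarrow>
     treedepth_decomposition G T r \<and> height T r = treedepth G"

text \<open>
  The minimiser below is unique: all vertices strictly above a branching vertex of smallest depth
  have a single child.
\<close>

definition top_separator :: "'a pair_pre_digraph \<Rightarrow> 'a \<Rightarrow> 'a set" where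
  "top_separator T r =
     (if \<forall>v \<in> pverts T. card (children T v) \<le> 1 then pverts T
      else root_path T r (ARG_MIN (depth T r) v. v \<in> pverts T \<and> card (children T v) > 1))"


section \<open>Treewidth\<close>

text \<open>
  The library's \<^const>\<open>tree\<close> is unsuitable for symmetric digraphs, in which every edge yields a
  cycle of length 2. In a simple graph, the cycles in the undirected sense are those of length at
  least 3.
\<close>

definition undirected_tree :: "'a pair_pre_digraph \<Rightarrow> bool" where
  "undirected_tree S \<longleftrightarrow> pair_graph S \<and> Digraph_Component.connected (with_proj S) \<and>
     \<not> (\<exists>p. pre_digraph.cycle (with_proj S) p \<and> length p \<ge> 3)"

definition tree_decomposition ::
    "'a pair_pre_digraph \<Rightarrow> 'b pair_pre_digraph \<Rightarrow> ('b \<Rightarrow> 'a set) \<Rightarrow> bool" where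
  "tree_decomposition G S B \<longleftrightarrow> undirected_tree S \<and>
     (\<Union>t \<in> pverts S. B t) = pverts G \<and>
     (\<forall>(u, v) \<in> parcs G. \<exists>t \<in> pverts S. u \<in> B t \<and> v \<in> B t) \<and>
     (\<forall>v \<in> pverts G. Digraph_Component.connected (with_proj S \<restriction> {t \<in> pverts S. v \<in> B t}))"

text \<open>For a graph with at least one vertex some bag is nonempty, so the subtraction is exact.\<close>

definition width :: "'b pair_pre_digraph \<Rightarrow> ('b \<Rightarrow> 'a set) \<Rightarrow> nat" where
  "width S B = Max ((\<lambda>t. card (B t)) ` pverts S) - 1"

text \<open>Every finite tree is isomorphic to one with natural numbers as nodes.\<close>

definition treewidth :: "'a pair_pre_digraph \<Rightarrow> nat" where
  "treewidth G = (LEAST k. \<exists>(S :: nat pair_pre_digraph) B. tree_decomposition G S B \<and> width S B = k)"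

end

theory Submission
  imports Defs
begin

text \<open>
  Once \<open>T\<close> branches, every leaf below the branching vertex lies strictly deeper than the top
  separator, so its size is at most \<open>td(G) - 1\<close>. A decomposition that does not branch has height
  \<open>|V(G)|\<close>, and is not optimal because two non-adjacent vertices can be put at the same depth.

  It remains to show \<open>td(G) \<le> tw(G) + 1\<close>. By induction on the construction of a cograph by disjoint
  unions and joins, there are a treedepth decomposition of height \<open>k\<close> and a bramble of order at least
  \<open>k\<close>. For the join of \<open>A\<close> and \<open>B\<close>, take both brambles together with all pairs \<open>{a, b}\<close>: a hitting set
  contains \<open>A\<close> or \<open>B\<close> and hits the bramble of the other side. By the Helly property of subtrees, some
  bag of a tree decomposition hits the whole bramble.
\<close>

section \<open>The Helly property of subtrees\<close>

text \<open>Connectedness by cuts rather than walks: for symmetric \<open>E\<close> it says that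
  \<open>A\<close> induces a connected graph, the empty set included. In this form unions and leaf
  deletions reduce to a choice of the right cut.\<close>

definition cut_connected :: "('a \<times> 'a) set \<Rightarrow> 'a set \<Rightarrow> bool" where
  "cut_connected E A \<longleftrightarrow> (\<forall>P \<subseteq> A. P \<noteq> {} \<longrightarrow> P \<noteq> A \<longrightarrow> (\<exists>x \<in> P. \<exists>y \<in> A - P. (x, y) \<in> E))"

lemma cut_connectedE:
  assumes "cut_connected E A" "P \<subseteq> A" "P \<noteq> {}" "P \<noteq> A"
  obtains x y where "x \<in> P" "y \<in> A" "y \<notin> P" "(x, y) \<in> E"
  using assms unfolding cut_connected_def by blast

text \<open>A common point lies on one side of any cut of the union, so the cut splits
  \<open>A\<close> or \<open>B\<close> properly, and the crossing edge is found there.\<close>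

lemma cut_connected_Un:
  assumes A: "cut_connected E A" and B: "cut_connected E B" and "A \<inter> B \<noteq> {}"
  shows "cut_connected E (A \<union> B)"
  unfolding cut_connected_def
proof (intro allI impI)
  fix P assume P: "P \<subseteq> A \<union> B" "P \<noteq> {}" "P \<noteq> A \<union> B"
  obtain c where c: "c \<in> A" "c \<in> B" using assms(3) by blast
  consider "P \<inter> A \<noteq> {} \<and> P \<inter> A \<noteq> A" | "P \<inter> B \<noteq> {} \<and> P \<inter> B \<noteq> B"
    using P c by blast
  then show "\<exists>x \<in> P. \<exists>y \<in> A \<union> B - P. (x, y) \<in> E"
  proof cases
    case 1
    then obtain x y where "x \<in> P \<inter> A" "y \<in> A" "y \<notin> P \<inter> A" "(x, y) \<in> E"
      by (meson A Int_lower2 cut_connectedE)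
    then show ?thesis by blast
  next
    case 2
    then obtain x y where "x \<in> P \<inter> B" "y \<in> B" "y \<notin> P \<inter> B" "(x, y) \<in> E"
      by (meson B Int_lower2 cut_connectedE)
    then show ?thesis by blast
  qed
qed

text \<open>Since \<open>m\<close> is the only possible neighbour of \<open>l\<close> in
  \<open>A\<close>, a cut of \<open>A - {l}\<close> extends to a cut of \<open>A\<close> with
  \<open>l\<close> on the side of \<open>m\<close>. The edge crossing the larger cut then avoids
  \<open>l\<close>.\<close>

lemma cut_connected_remove_leaf:
  assumes A: "cut_connected E A" and "sym E" and l: "\<And>x. x \<in> A \<Longrightarrow> (x, l) \<in> E \<Longrightarrow> x = m"
  shows "cut_connected E (A - {l})"
  unfolding cut_connected_def
proof (intro allI impI)
  fix P assume P: "P \<subseteq> A - {l}" "P \<noteq> {}" "P \<noteq> A - {l}"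
  show "\<exists>x \<in> P. \<exists>y \<in> A - {l} - P. (x, y) \<in> E"
  proof (cases "l \<in> A \<and> m \<in> P")
    case True
    have "insert l P \<subseteq> A" "insert l P \<noteq> {}" "insert l P \<noteq> A" using P True by auto
    then obtain x y where xy: "x \<in> insert l P" "y \<in> A" "y \<notin> insert l P" "(x, y) \<in> E"
      by (meson A cut_connectedE)
    have "x \<noteq> l" using xy True l[of y] \<open>sym E\<close> by (auto dest: symD)
    then show ?thesis using xy by blast
  next
    case False
    have "P \<subseteq> A" "P \<noteq> A" using P by auto
    then obtain x y where xy: "x \<in> P" "y \<in> A" "y \<notin> P" "(x, y) \<in> E"
      by (meson A P(2) cut_connectedE)
    have "y \<noteq> l" using xy False l[of x] P by auto
    then show ?thesis using xy by blast
  qed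
qed

text \<open>Induction by deleting a leaf \<open>l\<close>. The fourth assumption is the only
  acyclicity used: every nonempty set of nodes has a member with at most one neighbour in it. If
  \<open>{l}\<close> belongs to the family, then \<open>l\<close> is the common node; otherwise
  deleting \<open>l\<close> keeps all assumptions.\<close>

lemma helly_subtrees:
  assumes "finite N" "N \<noteq> {}" "sym E"
    and "\<And>M. M \<subseteq> N \<Longrightarrow> M \<noteq> {} \<Longrightarrow> \<exists>l \<in> M. \<exists>m. \<forall>x \<in> M. (x, l) \<in> E \<longrightarrow> x = m"
    and "\<And>A. A \<in> F \<Longrightarrow> A \<subseteq> N \<and> cut_connected E A"
    and "\<And>A B. A \<in> F \<Longrightarrow> B \<in> F \<Longrightarrow> A \<inter> B \<noteq> {}"
  shows "\<exists>t \<in> N. \<forall>A \<in> F. t \<in> A"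
  using assms(1,2,4-)
proof (induction N arbitrary: F rule: finite_psubset_induct)
  case (psubset N)
  obtain l m where l: "l \<in> N" "\<And>x. x \<in> N \<Longrightarrow> (x, l) \<in> E \<Longrightarrow> x = m"
    using psubset.prems(2)[of N] psubset.prems(1) by blast
  consider "F = {}" | "{l} \<in> F" | "F \<noteq> {}" "{l} \<notin> F" by blast
  then show ?case
  proof cases
    case 1
    then show ?thesis using l by auto
  next
    case 2
    then have "l \<in> A" if "A \<in> F" for A using psubset.prems(4)[OF 2 that] by auto
    then show ?thesis using l by auto
  next
    case 3
    \<comment> \<open>A connected member that contains \<open>l\<close> and is not
      \<open>{l}\<close> must leave \<open>l\<close> through its only neighbour.\<close>
    have m: "m \<in> A \<and> m \<noteq> l" if A: "A \<in> F" "l \<in> A" for A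
    proof -
      have "A \<noteq> {l}" using 3 A by auto
      then obtain x y where xy: "x \<in> {l}" "y \<in> A" "y \<notin> {l}" "(x, y) \<in> E"
        using A psubset.prems(3)[of A] cut_connectedE[of E A "{l}"] by blast
      moreover have "y = m" using xy l(2)[of y] A psubset.prems(3)[of A] \<open>sym E\<close> by (auto dest: symD)
      ultimately show ?thesis by auto
    qed
    let ?F = "(\<lambda>A. A - {l}) ` F"
    \<comment> \<open>Two members that meet only in \<open>l\<close> would both contain
      \<open>m\<close> as well.\<close>
    have meet: "(A - {l}) \<inter> (B - {l}) \<noteq> {}" if "A \<in> F" "B \<in> F" for A B
      using m[of A] m[of B] that psubset.prems(4)[of A B] by blast
    have "\<exists>t \<in> N - {l}. \<forall>A \<in> ?F. t \<in> A"
    proof (rule psubset.IH)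
      show "N - {l} \<subset> N" using l by auto
      obtain A where "A \<in> F" using 3 by auto
      then show "N - {l} \<noteq> {}" using meet[of A A] psubset.prems(3)[of A] by blast
      show "\<exists>l\<in>M. \<exists>m. \<forall>x\<in>M. (x, l) \<in> E \<longrightarrow> x = m" if "M \<subseteq> N - {l}" "M \<noteq> {}" for M
        using psubset.prems(2)[of M] that by blast
      show "A \<subseteq> N - {l} \<and> cut_connected E A" if "A \<in> ?F" for A
      proof -
        obtain A' where A': "A' \<in> F" "A = A' - {l}" using \<open>A \<in> ?F\<close> by auto
        have "cut_connected E (A' - {l})"
          using psubset.prems(3)[OF A'(1)] l(2)
          by (intro cut_connected_remove_leaf[OF _ \<open>sym E\<close>, where m = m]) auto
        then show ?thesis using A' psubset.prems(3)[OF A'(1)] by auto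
      qed
      show "A \<inter> B \<noteq> {}" if "A \<in> ?F" "B \<in> ?F" for A B
        using that meet by auto
    qed
    then show ?thesis by auto
  qed
qed

section \<open>Cographs\<close>

text \<open>A version of \<open>cograph\<close> for bare relations, so that it can be applied to
  \<open>- E\<close> too. Non-edges are listed in one direction, which describes an induced path
  when the relation is symmetric.\<close>

definition P4_free :: "('a \<times> 'a) set \<Rightarrow> 'a set \<Rightarrow> bool" where
  "P4_free E V \<longleftrightarrow> \<not> (\<exists>a \<in> V. \<exists>b \<in> V. \<exists>c \<in> V. \<exists>d \<in> V. distinct [a, b, c, d] \<and>
     (a, b) \<in> E \<and> (b, c) \<in> E \<and> (c, d) \<in> E \<and> (a, c) \<notin> E \<and> (a, d) \<notin> E \<and> (b, d) \<notin> E)"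

lemma P4_free_subset: "P4_free E V \<Longrightarrow> A \<subseteq> V \<Longrightarrow> P4_free E A"
  unfolding P4_free_def subset_iff by metis

text \<open>The path on four vertices is self-complementary: the complement of
  \<open>a, b, c, d\<close> is the path \<open>c, a, d, b\<close>.\<close>

lemma P4_free_complement:
  assumes "P4_free E V" "sym E"
  shows "P4_free (- E) V"
  unfolding P4_free_def
proof (intro notI, elim bexE)
  fix a b c d
  assume "a \<in> V" "b \<in> V" "c \<in> V" "d \<in> V" and *: "distinct [a, b, c, d] \<and>
     (a, b) \<in> - E \<and> (b, c) \<in> - E \<and> (c, d) \<in> - E \<and> (a, c) \<notin> - E \<and> (a, d) \<notin> - E \<and> (b, d) \<notin> - E"
  moreover have "distinct [c, a, d, b]" "(c, a) \<in> E" "(a, d) \<in> E" "(d, b) \<in> E"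
    "(c, d) \<notin> E" "(c, b) \<notin> E" "(a, b) \<notin> E"
    using * \<open>sym E\<close> by (auto dest: symD)
  ultimately show False using assms(1) unfolding P4_free_def by blast
qed

text \<open>With \<open>- E\<close> in place of \<open>E\<close> this says that \<open>V\<close> is the join of \<open>A\<close> and \<open>B\<close>.\<close>

definition separated :: "('a \<times> 'a) set \<Rightarrow> 'a set \<Rightarrow> 'a set \<Rightarrow> 'a set \<Rightarrow> bool" where
  "separated E V A B \<longleftrightarrow> A \<noteq> {} \<and> B \<noteq> {} \<and> A \<inter> B = {} \<and> A \<union> B = V \<and>
     (\<forall>a \<in> A. \<forall>b \<in> B. (a, b) \<notin> E)"

text \<open>This is the inductive step of the cograph decomposition. If neither the extended graph
  nor its complement splits, then \<open>v\<close> has a non-neighbour on one side and neighbours on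
  both, which yields an induced path. Since the relation is arbitrary, the lemma also covers joins,
  through \<open>- E\<close>.\<close>

lemma separated_insert:
  assumes "sym E" "P4_free E (insert v V)" "v \<notin> V" "separated E V A B"
  shows "\<exists>C D. separated E (insert v V) C D \<or> separated (- E) (insert v V) C D"
proof (rule ccontr)
  assume "\<not> ?thesis"
  then have conn: "\<not> separated E (insert v V) C D" and co: "\<not> separated (- E) (insert v V) C D" for C D
    by blast+
  have no_edge: "\<And>a b. a \<in> A \<Longrightarrow> b \<in> B \<Longrightarrow> (a, b) \<notin> E" "\<And>a b. a \<in> A \<Longrightarrow> b \<in> B \<Longrightarrow> (b, a) \<notin> E"
    and AB: "V = A \<union> B" "A \<noteq> {}" "B \<noteq> {}" "A \<inter> B = {}"
    using assms(1,4) unfolding separated_def by (auto dest: symD)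
  \<comment> \<open>An edge leaving the non-neighbours of \<open>v\<close> in \<open>A\<close> starts an induced path through \<open>v\<close> into \<open>B\<close>.\<close>
  have key: False
    if AB: "V = A \<union> B" "A \<noteq> {}" "B \<noteq> {}" "A \<inter> B = {}"
      and no_edge: "\<And>a b. a \<in> A \<Longrightarrow> b \<in> B \<Longrightarrow> (a, b) \<notin> E" "\<And>a b. a \<in> A \<Longrightarrow> b \<in> B \<Longrightarrow> (b, a) \<notin> E"
      and y: "y \<in> A" "(v, y) \<notin> E" for A B y
  proof -
    let ?P = "{a \<in> A. (v, a) \<notin> E}"
    \<comment> \<open>Without a neighbour of \<open>v\<close> in \<open>B\<close>, the sets
      \<open>insert v A\<close> and \<open>B\<close> would be separated.\<close>
    obtain z where z: "z \<in> B" "(v, z) \<in> E"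
      using conn[of "insert v A" B] AB no_edge assms(3) unfolding separated_def by auto
    obtain y' x where x: "y' \<in> ?P" "x \<in> A" "(v, x) \<in> E" "(y', x) \<in> E"
    proof -
      have "?P \<inter> (insert v V - ?P) = {}" "?P \<noteq> {}" "insert v V - ?P \<noteq> {}" "?P \<union> (insert v V - ?P) = insert v V"
        using y AB assms(3) by auto
      then obtain y' x where "y' \<in> ?P" "x \<in> insert v V - ?P" "(y', x) \<in> E"
        using conn[of ?P "insert v V - ?P"] unfolding separated_def by blast
      moreover from this have "x \<in> A" "(v, x) \<in> E"
        using AB no_edge \<open>sym E\<close> by (auto dest: symD)
      ultimately show ?thesis using that by blast
    qed
    have "(x, v) \<in> E" "(v, y') \<notin> E" "(y', v) \<notin> E" using x \<open>sym E\<close> by (auto dest: symD)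
    moreover have "distinct [y', x, v, z]" using x z AB assms(3) by auto
    moreover have "(y', z) \<notin> E" "(x, z) \<notin> E" using x z no_edge by auto
    ultimately show False
      using assms(2) x z AB unfolding P4_free_def by blast
  qed
  \<comment> \<open>If \<open>v\<close> were adjacent to all of \<open>V\<close>, the complement
    would separate \<open>{v}\<close> from \<open>V\<close>. The non-neighbour lies in
    \<open>A\<close> or in \<open>B\<close>, and \<open>key\<close> applies with the sides in either
    order.\<close>
  obtain y where y: "y \<in> V" "(v, y) \<notin> E"
    using co[of "{v}" V] AB assms(3) unfolding separated_def by auto
  show False
    using key[of A B y] key[of B A y] AB no_edge y by blast
qed

text \<open>Vertices are added one at a time. The claim is symmetric under complementation, so
  whichever of the graph and its complement splits before the addition,
  \<open>separated_insert\<close> applies to that relation.\<close>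

lemma P4_free_decompose:
  assumes "finite V" "sym E" "P4_free E V" "card V \<ge> 2"
  shows "\<exists>A B. separated E V A B \<or> separated (- E) V A B"
  using assms(1,3,4)
proof (induction V rule: finite_induct)
  case empty
  then show ?case by simp
next
  case (insert v V)
  have free: "P4_free E V" using insert.prems unfolding P4_free_def by blast
  have co: "sym (- E)" "P4_free (- E) (insert v V)"
    using \<open>sym E\<close> P4_free_complement insert.prems(1) by (auto simp: sym_def)
  show ?case
  proof (cases "card V \<ge> 2")
    case True
    then obtain A B where "separated E V A B \<or> separated (- E) V A B"
      using insert.IH[OF free] by blast
    then show ?thesis
      using separated_insert[OF \<open>sym E\<close> insert.prems(1) insert.hyps(2)]
        separated_insert[OF co insert.hyps(2)] by fastforce
  next
    case False
    then have "card V = 1" using insert by auto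
    then obtain w where "V = {w}" by (auto simp: card_1_singleton_iff)
    then have "separated E (insert v V) {v} {w} \<or> separated (- E) (insert v V) {v} {w}"
      using insert.hyps unfolding separated_def by auto
    then show ?thesis by blast
  qed
qed

section \<open>Brambles and treedepth of cographs\<close>

text \<open>For cographs, brambles whose members are single vertices and edges suffice.\<close>

definition bramble :: "('a \<times> 'a) set \<Rightarrow> 'a set \<Rightarrow> 'a set set \<Rightarrow> bool" where
  "bramble E V F \<longleftrightarrow>
     (\<forall>X \<in> F. X \<subseteq> V \<and> (\<exists>u v. X = {u, v} \<and> (u = v \<or> (u, v) \<in> E))) \<and>
     (\<forall>X \<in> F. \<forall>Y \<in> F. \<exists>x \<in> X. \<exists>y \<in> Y. x = y \<or> (x, y) \<in> E)"

text \<open>The order of a bramble is the least size of a hitting set; only lower bounds on it occur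
  below.\<close>

definition order_ge :: "'a set \<Rightarrow> 'a set set \<Rightarrow> nat \<Rightarrow> bool" where
  "order_ge V F k \<longleftrightarrow> (\<forall>H \<subseteq> V. (\<forall>X \<in> F. H \<inter> X \<noteq> {}) \<longrightarrow> k \<le> card H)"

text \<open>\<open>P\<close> holds the parent-to-child arcs of a rooted forest; \<open>d\<close> is the depth, counted from 0.\<close>

definition td_forest :: "('a \<times> 'a) set \<Rightarrow> 'a set \<Rightarrow> nat \<Rightarrow> ('a \<times> 'a) set \<Rightarrow> ('a \<Rightarrow> nat) \<Rightarrow> bool" where
  "td_forest E V k P d \<longleftrightarrow> P \<subseteq> V \<times> V \<and> single_valued (P\<inverse>) \<and>
     (\<forall>(u, v) \<in> P. d v = Suc (d u)) \<and>
     (\<forall>v \<in> V. d v < k \<and> (d v \<noteq> 0 \<longrightarrow> (\<exists>u. (u, v) \<in> P))) \<and>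
     (\<forall>u \<in> V. \<forall>v \<in> V. (u, v) \<in> E \<longrightarrow> (u, v) \<in> P\<^sup>* \<or> (v, u) \<in> P\<^sup>*)"

text \<open>Forests are allowed so that a disjoint union can be formed without a new root. For a
  connected graph the forest turns out to be a tree, by
  \<open>td_forest_single_root\<close>.\<close>

definition td_le :: "('a \<times> 'a) set \<Rightarrow> 'a set \<Rightarrow> nat \<Rightarrow> bool" where
  "td_le E V k \<longleftrightarrow> (\<exists>P d. td_forest E V k P d)"

section \<open>Building rooted forests by disjoint unions and new roots\<close>

lemma td_le_singleton: "td_le E {v} 1"
  unfolding td_le_def td_forest_def
  by (rule exI[of _ "{}"], rule exI[of _ "\<lambda>_. 0"]) auto

lemma td_forestI:
  assumes "P \<subseteq> V \<times> V"
    and "\<And>u u' v. (u, v) \<in> P \<Longrightarrow> (u', v) \<in> P \<Longrightarrow> u = u'"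
    and "\<And>u v. (u, v) \<in> P \<Longrightarrow> d v = Suc (d u)"
    and "\<And>v. v \<in> V \<Longrightarrow> d v < k"
    and "\<And>v. v \<in> V \<Longrightarrow> d v \<noteq> 0 \<Longrightarrow> \<exists>u. (u, v) \<in> P"
    and "\<And>u v. u \<in> V \<Longrightarrow> v \<in> V \<Longrightarrow> (u, v) \<in> E \<Longrightarrow> (u, v) \<in> P\<^sup>* \<or> (v, u) \<in> P\<^sup>*"
  shows "td_forest E V k P d"
  unfolding td_forest_def single_valued_def
proof (intro conjI ballI allI impI)
  show "\<And>v. v \<in> V \<Longrightarrow> d v \<noteq> 0 \<Longrightarrow> \<exists>u. (u, v) \<in> P" by (fact assms(5))
qed (use assms in auto)

lemma td_forestD:
  assumes "td_forest E V k P d"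
  shows "P \<subseteq> V \<times> V"
    and "(u, v) \<in> P \<Longrightarrow> (u', v) \<in> P \<Longrightarrow> u = u'"
    and "(u, v) \<in> P \<Longrightarrow> d v = Suc (d u)"
    and "v \<in> V \<Longrightarrow> d v < k"
    and "v \<in> V \<Longrightarrow> d v \<noteq> 0 \<Longrightarrow> \<exists>u. (u, v) \<in> P"
    and "u \<in> V \<Longrightarrow> v \<in> V \<Longrightarrow> (u, v) \<in> E \<Longrightarrow> (u, v) \<in> P\<^sup>* \<or> (v, u) \<in> P\<^sup>*"
  using assms unfolding td_forest_def single_valued_def by auto

lemma td_le_mono:
  assumes "td_le E V k" "k \<le> k'"
  shows "td_le E V k'"
proof -
  obtain P d where P: "td_forest E V k P d" using assms unfolding td_le_def by blast
  have "td_forest E V k' P d"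
  proof (rule td_forestI)
    show "d v < k'" if "v \<in> V" for v using td_forestD(4)[OF P that] assms(2) by simp
  qed (use td_forestD[OF P] in blast)+
  then show ?thesis unfolding td_le_def by blast
qed

lemma td_le_Un:
  assumes "td_le E A k" "td_le E B k" "separated E V A B" "sym E"
  shows "td_le E V k"
proof -
  obtain P d Q e where P: "td_forest E A k P d" and Q: "td_forest E B k Q e"
    using assms unfolding td_le_def by blast
  have AB: "A \<inter> B = {}" "V = A \<union> B" "\<And>a b. a \<in> A \<Longrightarrow> b \<in> B \<Longrightarrow> (a, b) \<notin> E \<and> (b, a) \<notin> E"
    using assms(3,4) unfolding separated_def by (auto dest: symD)
  let ?d = "\<lambda>v. if v \<in> A then d v else e v"
  note sub = td_forestD(1)[OF P] td_forestD(1)[OF Q]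
  have "td_forest E V k (P \<union> Q) ?d"
  proof (rule td_forestI)
    show "P \<union> Q \<subseteq> V \<times> V" using sub AB(2) by blast
    show "u = u'" if "(u, v) \<in> P \<union> Q" "(u', v) \<in> P \<union> Q" for u u' v
      using that sub AB(1) td_forestD(2)[OF P, of u v u'] td_forestD(2)[OF Q, of u v u'] by blast
    show "?d v = Suc (?d u)" if "(u, v) \<in> P \<union> Q" for u v
      using that sub AB(1) td_forestD(3)[OF P, of u v] td_forestD(3)[OF Q, of u v] by auto
    show "?d v < k" if "v \<in> V" for v
      using that AB(2) td_forestD(4)[OF P, of v] td_forestD(4)[OF Q, of v] by auto
    show "\<exists>u. (u, v) \<in> P \<union> Q" if "v \<in> V" "?d v \<noteq> 0" for v
      using that AB(2) td_forestD(5)[OF P, of v] td_forestD(5)[OF Q, of v]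
      by (cases "v \<in> A") auto
    show "(u, v) \<in> (P \<union> Q)\<^sup>* \<or> (v, u) \<in> (P \<union> Q)\<^sup>*" if uv: "u \<in> V" "v \<in> V" "(u, v) \<in> E" for u v
    proof -
      have "u \<in> A \<and> v \<in> A \<or> u \<in> B \<and> v \<in> B" using uv AB by blast
      moreover have "P\<^sup>* \<subseteq> (P \<union> Q)\<^sup>*" "Q\<^sup>* \<subseteq> (P \<union> Q)\<^sup>*" by (simp_all add: rtrancl_mono)
      ultimately show ?thesis
        using uv(3) td_forestD(6)[OF P, of u v] td_forestD(6)[OF Q, of u v] by blast
    qed
  qed
  then show ?thesis unfolding td_le_def by blast
qed

text \<open>The new vertex becomes the parent of all old roots and every depth grows by one. It is
  then an ancestor of everything, whatever edges it has.\<close>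

lemma td_le_insert:
  assumes "td_le E V k" "v \<notin> V"
  shows "td_le E (insert v V) (Suc k)"
proof -
  obtain P d where P: "td_forest E V k P d" using assms unfolding td_le_def by blast
  let ?Q = "P \<union> {(v, u) |u. u \<in> V \<and> d u = 0}"
  let ?d = "\<lambda>u. if u = v then 0 else Suc (d u)"
  note sub = td_forestD(1)[OF P]
  have mono: "P\<^sup>* \<subseteq> ?Q\<^sup>*" by (rule rtrancl_mono) auto
  have root: "(v, u) \<in> ?Q\<^sup>*" if "u \<in> V" for u
    using that
  proof (induction "d u" arbitrary: u rule: less_induct)
    case less
    show ?case
    proof (cases "d u = 0")
      case True
      then show ?thesis using less by auto
    next
      case False
      then obtain w where w: "(w, u) \<in> P" using td_forestD(5)[OF P] less by blast
      then have "d w < d u" "w \<in> V" using td_forestD(3)[OF P] sub by auto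
      then show ?thesis using less w by (meson UnI1 rtrancl.rtrancl_into_rtrancl)
    qed
  qed
  have "td_forest E (insert v V) (Suc k) ?Q ?d"
  proof (rule td_forestI)
    show "?Q \<subseteq> insert v V \<times> insert v V" using sub by blast
    show "u = u'" if "(u, w) \<in> ?Q" "(u', w) \<in> ?Q" for u u' w
      using that td_forestD(2)[OF P, of u w u'] td_forestD(3)[OF P, of u w] td_forestD(3)[OF P, of u' w]
      by auto
    show "?d w = Suc (?d u)" if "(u, w) \<in> ?Q" for u w
      using that sub assms(2) td_forestD(3)[OF P, of u w] by auto
    show "?d w < Suc k" if "w \<in> insert v V" for w
      using that td_forestD(4)[OF P, of w] by auto
    show "\<exists>u. (u, w) \<in> ?Q" if "w \<in> insert v V" "?d w \<noteq> 0" for w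
      using that td_forestD(5)[OF P, of w] by (cases "d w = 0") auto
    show "(u, w) \<in> ?Q\<^sup>* \<or> (w, u) \<in> ?Q\<^sup>*"
      if "u \<in> insert v V" "w \<in> insert v V" "(u, w) \<in> E" for u w
    proof (cases "u = v \<or> w = v")
      case True
      then show ?thesis using that root by auto
    next
      case False
      then show ?thesis using that mono td_forestD(6)[OF P, of u w] by blast
    qed
  qed
  then show ?thesis unfolding td_le_def by blast
qed

text \<open>The vertices of \<open>A\<close> are stacked as a chain above the forest on
  \<open>V\<close>. This gives the decomposition of a join, and of a graph with a non-adjacent pair
  at the bottom.\<close>

lemma td_le_Un_card:
  assumes "finite A" "td_le E V k" "A \<inter> V = {}"
  shows "td_le E (A \<union> V) (card A + k)"
  using assms by (induction A rule: finite_induct) (auto intro: td_le_insert)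

section \<open>Brambles under joins and enlargement, and the min-max statement for cographs\<close>

lemma brambleD:
  assumes "bramble E V F"
  shows "X \<in> F \<Longrightarrow> X \<subseteq> V"
    and "X \<in> F \<Longrightarrow> \<exists>u v. X = {u, v} \<and> (u = v \<or> (u, v) \<in> E)"
    and "X \<in> F \<Longrightarrow> Y \<in> F \<Longrightarrow> \<exists>x \<in> X. \<exists>y \<in> Y. x = y \<or> (x, y) \<in> E"
  using assms unfolding bramble_def by auto

lemma order_geD: "order_ge V F k \<Longrightarrow> H \<subseteq> V \<Longrightarrow> (\<And>X. X \<in> F \<Longrightarrow> H \<inter> X \<noteq> {}) \<Longrightarrow> k \<le> card H"
  unfolding order_ge_def by simp

text \<open>The minimum is the height obtained by stacking one side of the join above a forest for
  the other, in the better of the two ways; this is what makes the two bounds meet.\<close>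

lemma bramble_join:
  assumes "separated (- E) V A B" "sym E" "finite V"
    and F: "bramble E A F" "order_ge A F k" and F': "bramble E B F'" "order_ge B F' k'"
  shows "\<exists>F. bramble E V F \<and> order_ge V F (min (card A + k') (card B + k))"
proof -
  have AB: "A \<noteq> {}" "B \<noteq> {}" "A \<inter> B = {}" "V = A \<union> B"
    "\<And>a b. a \<in> A \<Longrightarrow> b \<in> B \<Longrightarrow> (a, b) \<in> E \<and> (b, a) \<in> E"
    using assms(1,2) unfolding separated_def by (auto dest: symD)
  let ?M = "{{a, b} |a b. a \<in> A \<and> b \<in> B}"
  have shape: "X \<subseteq> V \<and> (\<exists>u v. X = {u, v} \<and> (u = v \<or> (u, v) \<in> E))"
    if "X \<in> F \<union> F' \<union> ?M" for X
  proof -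
    consider "X \<in> F" | "X \<in> F'" | a b where "X = {a, b}" "a \<in> A" "b \<in> B"
      using \<open>X \<in> F \<union> F' \<union> ?M\<close> by blast
    then show ?thesis
    proof cases
      case 1
      then show ?thesis using brambleD(1,2)[OF F(1), of X] AB(4) by blast
    next
      case 2
      then show ?thesis using brambleD(1,2)[OF F'(1), of X] AB(4) by blast
    next
      case 3
      then show ?thesis using AB(4) AB(5)[of a b] by auto
    qed
  qed
  have touch: "\<exists>x \<in> X. \<exists>y \<in> Y. x = y \<or> (x, y) \<in> E"
    if "X \<in> F \<union> F' \<union> ?M" "Y \<in> F \<union> F' \<union> ?M" for X Y
  proof -
    have ne: "X \<noteq> {}" "Y \<noteq> {}" using shape that by auto
    \<comment> \<open>A mixed pair meets both sides. Hence, unless both members come from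
      \<open>F\<close> or both from \<open>F'\<close>, one meets \<open>A\<close> and the other
      meets \<open>B\<close>, and the join supplies an edge.\<close>
    have meets: "Z \<in> F \<and> Z \<subseteq> A \<or> Z \<in> F' \<and> Z \<subseteq> B \<or> (Z \<inter> A \<noteq> {} \<and> Z \<inter> B \<noteq> {})"
      if "Z \<in> F \<union> F' \<union> ?M" for Z
      using that brambleD(1)[OF F(1), of Z] brambleD(1)[OF F'(1), of Z] by auto
    note XY = meets[OF that(1)] meets[OF that(2)]
    consider "X \<in> F \<and> Y \<in> F" | "X \<in> F' \<and> Y \<in> F'"
      | "X \<inter> A \<noteq> {} \<and> Y \<inter> B \<noteq> {}" | "X \<inter> B \<noteq> {} \<and> Y \<inter> A \<noteq> {}"
      using XY ne by blast
    then show ?thesis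
    proof cases
      case 1
      then show ?thesis using brambleD(3)[OF F(1)] by simp
    next
      case 2
      then show ?thesis using brambleD(3)[OF F'(1)] by simp
    next
      case 3
      then show ?thesis using AB(5) by blast
    next
      case 4
      then show ?thesis using AB(5) by blast
    qed
  qed
  have "order_ge V (F \<union> F' \<union> ?M) (min (card A + k') (card B + k))"
    unfolding order_ge_def
  proof (intro allI impI)
    fix H assume H: "H \<subseteq> V" "\<forall>X \<in> F \<union> F' \<union> ?M. H \<inter> X \<noteq> {}"
    have "finite (H \<inter> A)" "finite (H \<inter> B)" using H(1) \<open>finite V\<close> by (auto intro: finite_subset)
    moreover have "(H \<inter> A) \<inter> (H \<inter> B) = {}" using AB(3) by blast
    ultimately have "card ((H \<inter> A) \<union> (H \<inter> B)) = card (H \<inter> A) + card (H \<inter> B)"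
      by (rule card_Un_disjoint)
    moreover have "(H \<inter> A) \<union> (H \<inter> B) = H" using H(1) AB(4) by blast
    ultimately have card: "card H = card (H \<inter> A) + card (H \<inter> B)" by (simp only:)
    have k: "k \<le> card (H \<inter> A)"
    proof (rule order_geD[OF F(2)])
      show "H \<inter> A \<inter> X \<noteq> {}" if "X \<in> F" for X
        using bspec[OF H(2), of X] brambleD(1)[OF F(1) that] that by blast
    qed simp
    have k': "k' \<le> card (H \<inter> B)"
    proof (rule order_geD[OF F'(2)])
      show "H \<inter> B \<inter> X \<noteq> {}" if "X \<in> F'" for X
        using bspec[OF H(2), of X] brambleD(1)[OF F'(1) that] that by blast
    qed simp
    have "A \<subseteq> H \<or> B \<subseteq> H"
    proof (rule ccontr)
      assume "\<not> ?thesis"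
      then obtain a b where "a \<in> A" "b \<in> B" "a \<notin> H" "b \<notin> H" by blast
      moreover from this have "{a, b} \<in> F \<union> F' \<union> ?M" by blast
      ultimately show False using bspec[OF H(2), of "{a, b}"] by simp
    qed
    then show "min (card A + k') (card B + k) \<le> card H"
      using card k k' by (auto simp: Int_absorb1)
  qed
  moreover have "bramble E V (F \<union> F' \<union> ?M)"
    unfolding bramble_def using shape touch by simp
  ultimately show ?thesis by blast
qed

text \<open>All members lie in \<open>A\<close>, so the part of a hitting set inside
  \<open>A\<close> is still a hitting set.\<close>

lemma order_ge_mono:
  assumes "order_ge A F k" "bramble E A F" "A \<subseteq> V" "finite V"
  shows "order_ge V F k"
  unfolding order_ge_def
proof (intro allI impI)
  fix H assume H: "H \<subseteq> V" "\<forall>X \<in> F. H \<inter> X \<noteq> {}"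
  have "k \<le> card (H \<inter> A)"
  proof (rule order_geD[OF assms(1)])
    show "H \<inter> A \<inter> X \<noteq> {}" if "X \<in> F" for X
      using bspec[OF H(2), of X] brambleD(1)[OF assms(2) that] that by blast
  qed simp
  also have "\<dots> \<le> card H" using H assms(4) by (meson card_mono finite_subset inf_le1)
  finally show "k \<le> card H" .
qed

lemma bramble_mono:
  assumes "bramble E A F" "A \<subseteq> V"
  shows "bramble E V F"
  unfolding bramble_def
proof (intro conjI ballI)
  show "X \<subseteq> V" if "X \<in> F" for X using brambleD(1)[OF assms(1) that] assms(2) by blast
qed (use brambleD(2,3)[OF assms(1)] in simp_all)

text \<open>The same \<open>k\<close> bounds the treedepth from above and the bramble order from
  below. Both bounds follow the decomposition alike: the maximum for a disjoint union, and the
  smaller of \<open>card A + k'\<close> and \<open>card B + k\<close> for a join.\<close>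

lemma cograph_duality:
  assumes "finite V" "V \<noteq> {}" "sym E" "P4_free E V"
  shows "\<exists>k F. td_le E V k \<and> bramble E V F \<and> order_ge V F k"
  using assms(1,2,4)
proof (induction V rule: finite_psubset_induct)
  case (psubset V)
  show ?case
  proof (cases "card V \<ge> 2")
    case False
    moreover have "card V \<noteq> 0" using psubset.hyps psubset.prems(1) by simp
    ultimately have "card V = 1" by simp
    then obtain v where v: "V = {v}" by (auto simp: card_1_singleton_iff)
    have "bramble E V {{v}}" "order_ge V {{v}} 1"
      using v unfolding bramble_def order_ge_def by (auto simp: subset_singleton_iff)
    then show ?thesis using td_le_singleton[of E v] v by blast
  next
    case True
    then obtain A B where sep: "separated E V A B \<or> separated (- E) V A B"
      using P4_free_decompose[OF psubset.hyps(1) \<open>sym E\<close> psubset.prems(2)] by blast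
    then have AB0: "A \<noteq> {}" "B \<noteq> {}" "V = A \<union> B" "A \<inter> B = {}"
      unfolding separated_def by auto
    have AB: "A \<subset> V" "B \<subset> V" "A \<noteq> {}" "B \<noteq> {}" "V = A \<union> B" "A \<inter> B = {}"
      using AB0 by auto
    have "P4_free E A" "P4_free E B"
      using P4_free_subset[OF psubset.prems(2)] AB(1,2) by auto
    then obtain k F k' F' where A: "td_le E A k" "bramble E A F" "order_ge A F k"
      and B: "td_le E B k'" "bramble E B F'" "order_ge B F' k'"
      using psubset.IH[OF AB(1,3)] psubset.IH[OF AB(2,4)] by auto
    have sub: "A \<subseteq> V" "B \<subseteq> V" using AB(1,2) by auto
    then have fin: "finite A" "finite B" using psubset.hyps by (auto intro: finite_subset)
    from sep show ?thesis
    proof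
      assume sep: "separated E V A B"
      have "td_le E V (max k k')"
        by (rule td_le_Un[OF td_le_mono[OF A(1)] td_le_mono[OF B(1)] sep \<open>sym E\<close>]) auto
      moreover have "\<exists>F. bramble E V F \<and> order_ge V F (max k k')"
      proof (cases "k' \<le> k")
        case True
        then show ?thesis
          using order_ge_mono[OF A(3,2) sub(1) psubset.hyps] bramble_mono[OF A(2) sub(1)]
          by (auto simp: max_def)
      next
        case False
        then show ?thesis
          using order_ge_mono[OF B(3,2) sub(2) psubset.hyps] bramble_mono[OF B(2) sub(2)]
          by (auto simp: max_def)
      qed
      ultimately show ?thesis by blast
    next
      assume sep: "separated (- E) V A B"
      have "td_le E V (card A + k')" "td_le E V (card B + k)"
        using td_le_Un_card[OF fin(1) B(1)] td_le_Un_card[OF fin(2) A(1)] AB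
        by (auto simp: Un_commute Int_commute)
      then have "td_le E V (min (card A + k') (card B + k))"
        by (simp add: min_def)
      then show ?thesis
        using bramble_join[OF sep \<open>sym E\<close> psubset.hyps A(2,3) B(2,3)] by blast
    qed
  qed
qed

text \<open>The non-adjacent vertices \<open>u\<close> and \<open>v\<close> form a forest of height
  1, and the remaining \<open>card V - 2\<close> vertices are stacked above it.\<close>

lemma td_le_not_complete:
  assumes "finite V" "u \<in> V" "v \<in> V" "u \<noteq> v" "(u, v) \<notin> E" "sym E"
  shows "td_le E V (card V - 1)"
proof -
  have "td_le E {u, v} 1"
    using td_le_Un[OF td_le_singleton[of E u] td_le_singleton[of E v], of "{u, v}"] assms
    unfolding separated_def by auto
  then have "td_le E ((V - {u, v}) \<union> {u, v}) (card (V - {u, v}) + 1)"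
    using assms by (intro td_le_Un_card) auto
  moreover have "(V - {u, v}) \<union> {u, v} = V" using assms by auto
  moreover have "card (V - {u, v}) + 1 = card V - 1"
    using assms card_mono[of V "{u, v}"] by (simp add: card_Diff_subset)
  ultimately show ?thesis by simp
qed


section \<open>Treewidth\<close>

lemma P4_free_if_cograph:
  assumes "pair_graph G" "cograph G"
  shows "P4_free (parcs G) (pverts G)"
  unfolding P4_free_def
proof (intro notI, elim bexE)
  interpret G: pair_graph G by fact
  fix a b c d
  assume V: "a \<in> pverts G" "b \<in> pverts G" "c \<in> pverts G" "d \<in> pverts G"
    and *: "distinct [a, b, c, d] \<and> (a, b) \<in> parcs G \<and> (b, c) \<in> parcs G \<and> (c, d) \<in> parcs G \<and>
     (a, c) \<notin> parcs G \<and> (a, d) \<notin> parcs G \<and> (b, d) \<notin> parcs G"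
  let ?W = "{a, b, c, d}"
  let ?H = "with_proj G \<restriction> ?W"
  \<comment> \<open>\<open>f\<close> numbers the vertices by their position on the path; the last
    branch is meant for \<open>d\<close>.\<close>
  define f :: "'a \<Rightarrow> nat" where "f x = (if x = a then 0 else if x = b then 1 else if x = c then 2 else 3)" for x
  let ?f = "\<lparr>iso_verts = f, iso_arcs = map_prod f f, iso_head = snd, iso_tail = fst\<rparr>"
  have f: "f a = 0" "f b = 1" "f c = 2" "f d = 3" using * by (auto simp: f_def)
  have inj: "inj_on f ?W" using f by (auto simp: inj_on_def)
  have loop: "(x, x) \<notin> parcs G" for x using G.no_loops' by blast
  have comm: "(x, y) \<in> parcs G \<longleftrightarrow> (y, x) \<in> parcs G" for x y
    using G.arcs_symmetric by blast
  have adj: "(a, b) \<in> parcs G" "(b, a) \<in> parcs G" "(b, c) \<in> parcs G" "(c, b) \<in> parcs G"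
      "(c, d) \<in> parcs G" "(d, c) \<in> parcs G" "(a, c) \<notin> parcs G" "(c, a) \<notin> parcs G"
      "(a, d) \<notin> parcs G" "(d, a) \<notin> parcs G" "(b, d) \<notin> parcs G" "(d, b) \<notin> parcs G"
    using * comm by blast+
  have arcs: "arcs ?H = {(a, b), (b, a), (b, c), (c, b), (c, d), (d, c)}"
  proof (intro equalityI subsetI)
    fix e assume "e \<in> arcs ?H"
    then obtain x y where xy: "e = (x, y)" "(x, y) \<in> parcs G" "x \<in> ?W" "y \<in> ?W"
      by (cases e) simp
    from xy(3,4) show "e \<in> {(a, b), (b, a), (b, c), (c, b), (c, d), (d, c)}"
      using xy(1,2) adj loop by (elim insertE emptyE) simp_all
  qed (use adj in auto)
  have "wf_digraph ?H"
    by (rule G.wellformed_induce_subgraph)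
  moreover have "inj_on (map_prod f f) (arcs ?H)"
    using map_prod_inj_on[OF inj inj] by (rule inj_on_subset) (unfold arcs, simp)
  ultimately have "pre_digraph.digraph_isomorphism ?H ?f"
    using inj by (auto simp: pre_digraph.digraph_isomorphism_def)
  moreover have "with_proj (path_graph 4) = app_iso ?f ?H"
  proof -
    have "{..<4} = {0, 1, 2, 3 :: nat}" by auto
    moreover have "{(i :: nat, j). i < 4 \<and> j < 4 \<and> (j = Suc i \<or> i = Suc j)} =
        {(0, 1), (1, 0), (1, 2), (2, 1), (2, 3), (3, 2)}" by auto
    ultimately show ?thesis
      unfolding app_iso_def arcs by (simp add: with_proj_def path_graph_def f)
  qed
  ultimately have "digraph_iso ?H (with_proj (path_graph 4))"
    unfolding digraph_iso_def by blast
  moreover have "induced_subgraph ?H (with_proj G)"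
    using V by (intro G.induced_induce) auto
  ultimately show False using assms(2) unfolding cograph_def by blast
qed

section \<open>From connected digraphs to the cut condition\<close>

lemma rtrancl_on_leaves:
  assumes "(x, y) \<in> rtrancl_on A R" "x \<in> P" "y \<notin> P"
  obtains a b where "a \<in> P" "b \<in> A" "b \<notin> P" "(a, b) \<in> R"
  using assms by (induction rule: rtrancl_on_induct) blast+

text \<open>\<open>connected\<close> means strong connectivity of the symmetric closure, which adds
  no arcs here. A walk from one side of a cut to the other has a step that crosses it.\<close>

lemma cut_connected_if_connected:
  assumes "connected H" "sym (arcs_ends H)"
  shows "verts H \<noteq> {}" "cut_connected (arcs_ends H) (verts H)"
proof -
  let ?K = "mk_symmetric H"
  have K: "pverts ?K = verts H" "parcs ?K \<subseteq> arcs_ends H"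
    using assms(2) by (auto simp: mk_symmetric_def arcs_ends_conv dest: symD)
  show "verts H \<noteq> {}" using assms K unfolding connected_def strongly_connected_def by simp
  show "cut_connected (arcs_ends H) (verts H)"
    unfolding cut_connected_def
  proof (intro allI impI)
    fix P assume P: "P \<subseteq> verts H" "P \<noteq> {}" "P \<noteq> verts H"
    then obtain x y where xy: "x \<in> P" "x \<in> verts H" "y \<in> verts H" "y \<notin> P" by blast
    then have "(x, y) \<in> rtrancl_on (verts H) (parcs ?K)"
      using assms(1) K unfolding connected_def strongly_connected_def reachable_def by simp
    then show "\<exists>x\<in>P. \<exists>y\<in>verts H - P. (x, y) \<in> arcs_ends H"
      using xy K(2) by (elim rtrancl_on_leaves) auto
  qed
qed

lemma cut_connected_mono: "cut_connected E A \<Longrightarrow> E \<subseteq> E' \<Longrightarrow> cut_connected E' A"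
  unfolding cut_connected_def by (meson subsetD)

lemma cut_connected_induce:
  assumes "connected (with_proj S \<restriction> A)" "sym (parcs S)"
  shows "A \<noteq> {}" "cut_connected (parcs S) A"
proof -
  let ?H = "with_proj S \<restriction> A"
  have ends: "arcs_ends ?H = parcs S \<inter> A \<times> A"
    by (auto simp: arcs_ends_conv induce_subgraph_def image_iff)
  then have "sym (arcs_ends ?H)" using assms(2) by (auto simp: sym_def)
  note * = cut_connected_if_connected[OF assms(1) this]
  show "A \<noteq> {}" using *(1) by simp
  show "cut_connected (parcs S) A"
    using *(2) ends by (auto intro: cut_connected_mono)
qed

text \<open>A longest path inside \<open>M\<close> starts at a leaf \<open>u\<close>. A neighbour of
  \<open>u\<close> in \<open>M\<close> off the path would prolong it, and one on the path beyond the
  second vertex would close a cycle.\<close>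

lemma undirected_tree_leaf:
  assumes "undirected_tree S" "M \<subseteq> pverts S" "M \<noteq> {}"
  shows "\<exists>l \<in> M. \<exists>m. \<forall>x \<in> M. (x, l) \<in> parcs S \<longrightarrow> x = m"
proof -
  interpret S: pair_graph S using assms(1) unfolding undirected_tree_def by blast
  have acyclic: "\<not> (S.cycle p \<and> length p \<ge> 3)" for p
    using assms(1) unfolding undirected_tree_def by blast
  let ?Q = "\<lambda>(u, p, v). S.apath u p v \<and> set (pawalk_verts u p) \<subseteq> M"
  obtain x where "x \<in> M" using assms(3) by blast
  then have "?Q (x, [], x)" using assms(2) by (auto simp: S.apath_Nil_iff)
  moreover have "\<forall>t. ?Q t \<longrightarrow> length (fst (snd t)) < Suc (card (pverts S))"
    using S.length_apath by (auto simp: less_Suc_eq_le)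
  ultimately obtain t where t: "?Q t" "\<And>s. ?Q s \<Longrightarrow> length (fst (snd s)) \<le> length (fst (snd t))"
    using ex_has_greatest_nat[of ?Q _ "\<lambda>t. length (fst (snd t))"] by blast
  obtain u p v where upv: "t = (u, p, v)" by (cases t)
  have p: "S.apath u p v" "set (pawalk_verts u p) \<subseteq> M" using t(1) upv by auto
  \<comment> \<open>\<open>snd (hd p)\<close> is the second vertex of the path. If \<open>p\<close>
    is empty, no such \<open>x\<close> exists.\<close>
  have "x = snd (hd p)" if x: "x \<in> M" "(x, u) \<in> parcs S" for x
  proof -
    have "x \<in> set (pawalk_verts u p)"
    proof (rule ccontr)
      assume "x \<notin> set (pawalk_verts u p)"
      then have "?Q (x, (x, u) # p, v)" using p x by (auto simp: S.apath_Cons_iff)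
      then show False using t(2)[of "(x, (x, u) # p, v)"] upv by simp
    qed
    then obtain q r where qr: "p = q @ r" "S.awalk u q x"
      using S.awalk_decomp p(1) unfolding S.apath_def by blast
    then have q: "S.apath u q x"
      using p(1) S.apath_append_iff by (metis S.awalkE' S.apath_def)
    have "x \<noteq> u" using x S.no_loops' by blast
    then obtain e q' where e: "q = e # q'" using qr(2) by (cases q) (auto simp: S.awalk_Nil_iff)
    show ?thesis
    proof (cases q')
      case Nil
      then show ?thesis using qr e by (auto simp: S.awalk_simps)
    next
      case (Cons e' q'')
      \<comment> \<open>Here \<open>q\<close> has at least two arcs, so the closing arc gives a
        cycle of length at least 3.\<close>
      have "S.awalk x ((x, u) # q) x" using x qr(2) by (auto simp: S.awalk_Cons_iff)
      moreover have "distinct (tl (pawalk_verts x ((x, u) # q)))"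
        using q unfolding S.apath_def by simp
      ultimately have "S.cycle ((x, u) # q)" unfolding S.cycle_def by blast
      then show ?thesis using acyclic e Cons by fastforce
    qed
  qed
  moreover have "u \<in> M" using p unfolding S.apath_def by (auto simp: S.hd_in_awalk_verts)
  ultimately show ?thesis by blast
qed

text \<open>The nodes whose bags meet a member \<open>{u, v}\<close> form the union of two subtrees
  sharing a node. Touching members have intersecting node sets, so the Helly property yields one
  node for all members.\<close>

lemma tree_decomposition_bramble:
  assumes T: "tree_decomposition G S B" and F: "bramble (parcs G) (pverts G) F"
  shows "\<exists>t \<in> pverts S. \<forall>X \<in> F. B t \<inter> X \<noteq> {}"
proof -
  have tree: "undirected_tree S" using T unfolding tree_decomposition_def by blast
  then interpret S: pair_graph S unfolding undirected_tree_def by blast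
  have sym: "sym (parcs S)" using S.arcs_symmetric by (auto intro: symI)
  have "pverts S \<noteq> {}"
    using tree unfolding undirected_tree_def connected_def strongly_connected_def
    by (auto simp: mk_symmetric_def)
  let ?T = "\<lambda>X. {t \<in> pverts S. B t \<inter> X \<noteq> {}}"
  have edge: "\<exists>t \<in> pverts S. u \<in> B t \<and> v \<in> B t" if "(u, v) \<in> parcs G" for u v
    using T that unfolding tree_decomposition_def by auto
  have conn: "{t \<in> pverts S. v \<in> B t} \<noteq> {}" "cut_connected (parcs S) {t \<in> pverts S. v \<in> B t}"
    if "v \<in> pverts G" for v
    using T that cut_connected_induce[OF _ sym] unfolding tree_decomposition_def by blast+
  have "\<exists>t \<in> pverts S. \<forall>A \<in> ?T ` F. t \<in> A"
  proof (rule helly_subtrees[OF S.pair_finite_verts \<open>pverts S \<noteq> {}\<close> sym])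
    show "\<exists>l\<in>M. \<exists>m. \<forall>x\<in>M. (x, l) \<in> parcs S \<longrightarrow> x = m" if "M \<subseteq> pverts S" "M \<noteq> {}" for M
      using undirected_tree_leaf[OF tree that] .
    show "A \<subseteq> pverts S \<and> cut_connected (parcs S) A" if A: "A \<in> ?T ` F" for A
    proof -
      obtain X where X: "X \<in> F" "A = ?T X" using A by auto
      obtain u v where uv: "X = {u, v}" "u = v \<or> (u, v) \<in> parcs G"
        using brambleD(2)[OF F X(1)] by auto
      have V: "u \<in> pverts G" "v \<in> pverts G" using brambleD(1)[OF F X(1)] uv by auto
      have "{t \<in> pverts S. u \<in> B t} \<inter> {t \<in> pverts S. v \<in> B t} \<noteq> {}"
        using uv(2) conn(1)[OF V(1)] edge[of u v] by auto
      then have "cut_connected (parcs S) ({t \<in> pverts S. u \<in> B t} \<union> {t \<in> pverts S. v \<in> B t})"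
        using cut_connected_Un conn(2) V by blast
      moreover have "{t \<in> pverts S. u \<in> B t} \<union> {t \<in> pverts S. v \<in> B t} = A"
        using X uv(1) by auto
      ultimately show ?thesis using X by auto
    qed
    show "A \<inter> A' \<noteq> {}" if A: "A \<in> ?T ` F" "A' \<in> ?T ` F" for A A'
    proof -
      obtain X where X: "X \<in> F" "A = ?T X" using A(1) by auto
      obtain Y where Y: "Y \<in> F" "A' = ?T Y" using A(2) by auto
      obtain x y where xy: "x \<in> X" "y \<in> Y" "x = y \<or> (x, y) \<in> parcs G"
        using brambleD(3)[OF F X(1) Y(1)] by auto
      then have "\<exists>t \<in> pverts S. x \<in> B t \<and> y \<in> B t"
        using edge[of x y] conn(1)[of x] brambleD(1)[OF F X(1)] by auto
      then show ?thesis using X Y xy by auto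
    qed
  qed
  then show ?thesis by auto
qed

text \<open>A single bag with all vertices suffices. Existence is what ensures that the
  \<open>LEAST\<close> in \<open>treewidth\<close> is attained.\<close>

lemma ex_nat_tree_decomposition:
  assumes "pair_wf_digraph G"
  shows "\<exists>(S :: nat pair_pre_digraph) B. tree_decomposition G S B"
proof -
  interpret G: pair_wf_digraph G by fact
  let ?S = "\<lparr>pverts = {0 :: nat}, parcs = {}\<rparr>"
  interpret S: pair_graph ?S
    by unfold_locales (auto simp: symmetric_def arcs_ends_conv with_proj_def sym_def)
  have conn: "connected (with_proj ?S)" "connected (with_proj ?S \<restriction> {0})"
    by (auto simp: connected_def strongly_connected_def reachable_def mk_symmetric_def)
  have "\<not> S.cycle p" for p
    unfolding S.cycle_def by (cases p) (auto simp: S.awalk_simps)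
  then have "undirected_tree ?S"
    unfolding undirected_tree_def using conn S.pair_graph by blast
  then have "tree_decomposition G ?S (\<lambda>_. pverts G)"
    unfolding tree_decomposition_def using conn G.wellformed' by auto
  then show ?thesis by blast
qed

text \<open>In a decomposition of least width, the bag that hits every member has at least
  \<open>k\<close> vertices. The \<open>+ 1\<close> undoes the subtraction in
  \<open>width\<close>.\<close>

lemma treewidth_ge_bramble_order:
  assumes "pair_graph G" and F: "bramble (parcs G) (pverts G) F" "order_ge (pverts G) F k"
  shows "k \<le> treewidth G + 1"
proof -
  interpret G: pair_graph G by fact
  have "\<exists>k. \<exists>(S :: nat pair_pre_digraph) B. tree_decomposition G S B \<and> width S B = k"
    using ex_nat_tree_decomposition[OF G.pair_wf_digraph] by blast
  then have "\<exists>(S :: nat pair_pre_digraph) B. tree_decomposition G S B \<and> width S B = treewidth G"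
    unfolding treewidth_def by (rule LeastI_ex)
  then obtain S :: "nat pair_pre_digraph" and B
    where T: "tree_decomposition G S B" and w: "width S B = treewidth G" by blast
  interpret S: pair_graph S
    using T unfolding tree_decomposition_def undirected_tree_def by blast
  obtain t where t: "t \<in> pverts S" "\<forall>X \<in> F. B t \<inter> X \<noteq> {}"
    using tree_decomposition_bramble[OF T F(1)] by blast
  have "B t \<subseteq> pverts G" using T t(1) unfolding tree_decomposition_def by blast
  then have "k \<le> card (B t)" using order_geD[OF F(2)] t(2) by blast
  also have "\<dots> \<le> Max ((\<lambda>t. card (B t)) ` pverts S)"
    using t(1) S.pair_finite_verts by (intro Max_ge) auto
  finally show ?thesis using w unfolding width_def by simp
qed


section \<open>Treedepth decompositions\<close>

lemma root_path_eq:
  assumes "rooted_tree T r" "v \<in> pverts T" "pre_digraph.awalk (with_proj T) r p v"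
  shows "root_path T r v = set (pawalk_verts r p)"
proof -
  have "(THE p. pre_digraph.awalk (with_proj T) r p v) = p"
    using assms unfolding rooted_tree_def by (auto intro: the1_equality)
  then show ?thesis unfolding root_path_def by simp
qed

lemma rooted_tree_awalk:
  assumes "rooted_tree T r" "v \<in> pverts T"
  obtains p where "pre_digraph.awalk (with_proj T) r p v" "root_path T r v = set (pawalk_verts r p)"
  using assms root_path_eq[OF assms] unfolding rooted_tree_def by blast

lemma root_path_endpoints:
  assumes "rooted_tree T r" "v \<in> pverts T"
  shows "v \<in> root_path T r v" "r \<in> root_path T r v" "root_path T r v \<subseteq> pverts T"
    "finite (root_path T r v)"
proof -
  interpret T: pair_wf_digraph T using assms(1) unfolding rooted_tree_def by blast
  obtain p where p: "T.awalk r p v" "root_path T r v = set (pawalk_verts r p)"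
    using rooted_tree_awalk[OF assms] .
  show "v \<in> root_path T r v" "r \<in> root_path T r v" "root_path T r v \<subseteq> pverts T"
    "finite (root_path T r v)"
    using p T.awalk_verts_in_verts by (auto elim!: T.awalkE' simp: T.hd_in_awalk_verts)
qed

text \<open>The walk to \<open>u\<close> is prolonged by the arc to \<open>c\<close>. If
  \<open>c\<close> were already on it, a prefix would be a second walk from the root to
  \<open>c\<close>, against uniqueness.\<close>

lemma root_path_child:
  assumes T: "rooted_tree T r" and uc: "(u, c) \<in> parcs T"
  shows "root_path T r c = insert c (root_path T r u)" "c \<notin> root_path T r u"
proof -
  interpret T: pair_wf_digraph T using T unfolding rooted_tree_def by blast
  have V: "u \<in> pverts T" "c \<in> pverts T" using uc T.wellformed' by auto
  obtain p where p: "T.awalk r p u" "root_path T r u = set (pawalk_verts r p)"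
    using rooted_tree_awalk[OF T V(1)] .
  have edge: "T.awalk u [(u, c)] c" using uc V by (auto simp: T.awalk_simps)
  have pc: "T.awalk r (p @ [(u, c)]) c" using p(1) edge by (rule T.awalk_appendI)
  have "root_path T r c = set (pawalk_verts r (p @ [(u, c)]))"
    using root_path_eq[OF T V(2) pc] .
  also have "\<dots> = set (pawalk_verts r p) \<union> set (pawalk_verts u [(u, c)])"
    using T.set_awalk_verts_append[OF p(1) edge] .
  finally show "root_path T r c = insert c (root_path T r u)"
    using root_path_endpoints(1)[OF T V(1)] p(2) by auto
  show "c \<notin> root_path T r u"
  proof
    assume "c \<in> root_path T r u"
    then obtain q s where qs: "p = q @ s" "T.awalk r q c"
      using T.awalk_decomp[OF p(1)] p(2) by blast
    have "\<exists>!p. T.awalk r p c" using T V(2) unfolding rooted_tree_def by blast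
    then have "q = p @ [(u, c)]" using qs(2) pc by blast
    then show False using qs(1) by simp
  qed
qed

text \<open>For a vertex where an arc leaves a root path, this supplies another child, one on the
  path; it serves to detect branching.\<close>

lemma root_path_successor:
  assumes T: "rooted_tree T r" and v: "v \<in> pverts T" and x: "x \<in> root_path T r v" "x \<noteq> v"
  obtains y where "(x, y) \<in> parcs T" "y \<in> root_path T r v"
proof -
  interpret T: pair_wf_digraph T using T unfolding rooted_tree_def by blast
  obtain p where p: "T.awalk r p v" "root_path T r v = set (pawalk_verts r p)"
    using rooted_tree_awalk[OF T v] .
  obtain q s where qs: "p = q @ s" "T.awalk r q x" "T.awalk x s v"
    using T.awalk_decomp[OF p(1)] x(1) p(2) by blast
  obtain e s' where s: "s = e # s'" using qs(3) x(2) by (cases s) (auto simp: T.awalk_Nil_iff)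
  have "root_path T r v = set (pawalk_verts r q) \<union> set (pawalk_verts x s)"
    using T.set_awalk_verts_append[OF qs(2,3)] p(2) qs(1) by simp
  moreover have "snd e \<in> set (pawalk_verts x s)"
    using qs(3) s T.hd_in_awalk_verts by (auto simp: T.awalk_Cons_iff)
  moreover have "(x, snd e) \<in> parcs T" using qs(3) s by (auto simp: T.awalk_Cons_iff)
  ultimately show thesis using that by blast
qed

text \<open>Among the vertices whose root path contains that of \<open>w\<close>, take one with the
  largest root path; a child of it would have a larger one.\<close>

lemma leaf_below:
  assumes T: "rooted_tree T r" and fin: "finite (pverts T)" and w: "w \<in> pverts T"
  obtains l where "leaf T l" "root_path T r w \<subseteq> root_path T r l"
proof -
  interpret T: pair_wf_digraph T using T unfolding rooted_tree_def by blast
  let ?Q = "\<lambda>l. l \<in> pverts T \<and> root_path T r w \<subseteq> root_path T r l"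
  have "\<forall>l. ?Q l \<longrightarrow> card (root_path T r l) < Suc (card (pverts T))"
    using root_path_endpoints(3)[OF T] fin by (auto simp: less_Suc_eq_le intro: card_mono)
  then obtain l where l: "?Q l" "\<And>m. ?Q m \<Longrightarrow> card (root_path T r m) \<le> card (root_path T r l)"
    using ex_has_greatest_nat[of ?Q w "\<lambda>l. card (root_path T r l)"] w by blast
  have "(l, c) \<notin> parcs T" for c
  proof
    assume lc: "(l, c) \<in> parcs T"
    note child = root_path_child[OF T lc]
    have "?Q c" using child(1) l(1) T.wellformed'(2)[OF lc] by auto
    then have "card (insert c (root_path T r l)) \<le> card (root_path T r l)"
      using l(2)[of c] child(1) by simp
    then show False using child(2) root_path_endpoints(4)[OF T] l(1) by simp
  qed
  then have "leaf T l" using l(1) unfolding leaf_def children_def by auto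
  then show thesis using that l(1) by blast
qed

section \<open>Height of branching and non-branching trees\<close>

lemma depth_le_height:
  assumes "finite (pverts T)" "leaf T l"
  shows "depth T r l \<le> height T r"
proof -
  have "finite {depth T r v |v. leaf T v}"
    using assms(1) unfolding leaf_def by (simp add: setcompr_eq_image)
  then show ?thesis unfolding height_def using assms(2) by (intro Max_ge) auto
qed

text \<open>If some vertex is off the root path of a leaf, an arc leaves that path at a vertex
  \<open>x\<close>. Since \<open>x\<close> is not the leaf, it also has a child on the path, so it
  branches.\<close>

lemma unbranched_height:
  assumes T: "rooted_tree T r" and fin: "finite (pverts T)"
    and unbranched: "\<forall>v \<in> pverts T. card (children T v) \<le> 1"
  shows "card (pverts T) \<le> height T r"
proof -
  interpret T: pair_wf_digraph T using T unfolding rooted_tree_def by blast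
  have r: "r \<in> pverts T" using T unfolding rooted_tree_def by blast
  obtain l where l: "leaf T l" using leaf_below[OF T fin r] by blast
  then have lV: "l \<in> pverts T" unfolding leaf_def by blast
  have "pverts T \<subseteq> root_path T r l"
  proof (rule ccontr)
    assume "\<not> ?thesis"
    then obtain v where v: "v \<in> pverts T" "v \<notin> root_path T r l" by blast
    then have "r \<rightarrow>\<^sup>*\<^bsub>with_proj T\<^esub> v"
      using T unfolding rooted_tree_def T.reachable_awalk by blast
    then have "(r, v) \<in> rtrancl_on (pverts T) (parcs T)" unfolding reachable_def by simp
    then obtain x c where xc: "x \<in> root_path T r l" "c \<notin> root_path T r l" "(x, c) \<in> parcs T"
      using root_path_endpoints(2)[OF T lV] v(2) by (elim rtrancl_on_leaves)
    have "x \<noteq> l" using l xc(3) unfolding leaf_def children_def by auto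
    then obtain y where y: "(x, y) \<in> parcs T" "y \<in> root_path T r l"
      using root_path_successor[OF T lV xc(1)] by blast
    have "children T x \<subseteq> pverts T" using T.wellformed' unfolding children_def by auto
    then have "card {y, c} \<le> card (children T x)"
      using xc y fin by (intro card_mono) (auto simp: children_def intro: finite_subset)
    moreover have "y \<noteq> c" using xc y by blast
    ultimately show False using unbranched T.wellformed'(1)[OF xc(3)] by force
  qed
  then have "card (pverts T) \<le> depth T r l"
    unfolding depth_def using root_path_endpoints(4)[OF T lV] by (rule card_mono[rotated])
  also have "\<dots> \<le> height T r" using depth_le_height[OF fin l] .
  finally show ?thesis .
qed

text \<open>The root path of the branching vertex \<open>p\<close> grows by one vertex at a child
  \<open>c\<close>, and continues to some leaf.\<close>

lemma top_separator_lt_height: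
  assumes T: "rooted_tree T r" and fin: "finite (pverts T)"
    and branched: "\<not> (\<forall>v \<in> pverts T. card (children T v) \<le> 1)"
  shows "card (top_separator T r) < height T r"
proof -
  interpret T: pair_wf_digraph T using T unfolding rooted_tree_def by blast
  define p where "p = (ARG_MIN (depth T r) v. v \<in> pverts T \<and> card (children T v) > 1)"
  have "\<exists>v. v \<in> pverts T \<and> card (children T v) > 1" using branched by force
  then have p: "p \<in> pverts T" "card (children T p) > 1"
    unfolding p_def by (metis (mono_tags, lifting) arg_min_natI)+
  then obtain c where c: "(p, c) \<in> parcs T"
    unfolding children_def by (metis (mono_tags, lifting) Collect_empty_eq card.empty not_less_zero)
  have cV: "c \<in> pverts T" using T.wellformed' c by blast
  obtain l where l: "leaf T l" "root_path T r c \<subseteq> root_path T r l"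
    using leaf_below[OF T fin cV] .
  have "card (top_separator T r) = card (root_path T r p)"
    using branched unfolding top_separator_def p_def by auto
  also have "\<dots> < card (root_path T r c)"
    using root_path_child[OF T c] root_path_endpoints(4)[OF T p(1)] by simp
  also have "\<dots> \<le> depth T r l"
    unfolding depth_def using l root_path_endpoints(4)[OF T, of l]
    by (intro card_mono) (auto simp: leaf_def)
  also have "\<dots> \<le> height T r" using depth_le_height[OF fin l(1)] .
  finally show ?thesis .
qed

section \<open>From depth-labelled forests to treedepth decompositions\<close>

lemma td_forest_single_root:
  assumes F: "td_forest E V k P d" and conn: "cut_connected E V" and "sym E"
    and r: "r \<in> V" "d r = 0" and v: "v \<in> V"
  shows "(r, v) \<in> P\<^sup>*"
proof (rule ccontr)
  assume nv: "(r, v) \<notin> P\<^sup>*"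
  let ?R = "{x \<in> V. (r, x) \<in> P\<^sup>*}"
  have level: "d x \<le> d y" if "(x, y) \<in> P\<^sup>*" for x y
    using that by (induction rule: rtrancl_induct) (auto dest: td_forestD(3)[OF F])
  have "?R \<subseteq> V" "?R \<noteq> {}" "?R \<noteq> V" using r v nv by auto
  \<comment> \<open>An edge leaves the set of descendants of \<open>r\<close>. Its outer end
    \<open>y\<close> cannot be below \<open>x\<close>, so it is an ancestor of
    \<open>x\<close>.\<close>
  then obtain x y where xy: "x \<in> ?R" "y \<in> V" "y \<notin> ?R" "(x, y) \<in> E"
    using conn by (rule_tac cut_connectedE)
  have "(x, y) \<in> P\<^sup>* \<or> (y, x) \<in> P\<^sup>*" using td_forestD(6)[OF F] xy by blast
  then have yx: "(y, x) \<in> P\<^sup>*" using xy by (auto dest: rtrancl_trans)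
  have "single_valued (P\<inverse>)" using F unfolding td_forest_def by blast
  \<comment> \<open>Parents are unique, so the ancestors of \<open>x\<close> form a chain, and
    \<open>r\<close> and \<open>y\<close> are comparable. As \<open>y\<close> is not below
    \<open>r\<close>, it is above it, but a vertex of depth 0 has no parent.\<close>
  then have "(r, y) \<in> (P\<inverse>)\<^sup>* \<or> (y, r) \<in> (P\<inverse>)\<^sup>*"
    using single_valued_confluent[of "P\<inverse>" x r y] yx xy(1) by (auto simp: rtrancl_converse)
  then have yr: "(y, r) \<in> P\<^sup>*" using xy(2,3) by (auto simp: rtrancl_converse)
  then have "d y = 0" using level r(2) by fastforce
  have "y = r"
    using yr
  proof (cases rule: rtranclE)
    case (step z)
    then show ?thesis using td_forestD(3)[OF F, of z r] r(2) by simp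
  qed simp
  then show False using xy by auto
qed

text \<open>The forest of a connected graph hangs below one root, so its arcs form a rooted tree.
  Walks from the root are unique because the depth fixes their length and unique parents fix their
  arcs.\<close>

lemma treedepth_le:
  assumes "pair_graph G" "connected (with_proj G)" "td_le (parcs G) (pverts G) k"
  shows "treedepth G \<le> k"
proof -
  interpret G: pair_graph G by fact
  have sym: "sym (parcs G)" using G.arcs_symmetric by (auto intro: symI)
  then have ne: "pverts G \<noteq> {}" and conn: "cut_connected (parcs G) (pverts G)"
    using cut_connected_if_connected[OF assms(2)] by auto
  obtain P d where F: "td_forest (parcs G) (pverts G) k P d"
    using assms(3) unfolding td_le_def by blast
  define T where "T = \<lparr>pverts = pverts G, parcs = P\<rparr>"
  have T [simp]: "pverts T = pverts G" "parcs T = P" by (simp_all add: T_def)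
  interpret T: pair_wf_digraph T
  proof
    fix e assume "e \<in> parcs T"
    then have "e \<in> pverts G \<times> pverts G" using subsetD[OF td_forestD(1)[OF F]] by simp
    then show "fst e \<in> pverts T" "snd e \<in> pverts T" by (simp_all add: mem_Times_iff)
  qed
  obtain r where r: "r \<in> pverts G" "d r = 0"
  proof -
    \<comment> \<open>A vertex of least depth is a root, since a parent would have smaller
      depth.\<close>
    obtain v where v: "v \<in> pverts G" "\<And>u. u \<in> pverts G \<Longrightarrow> d v \<le> d u"
      using ne ex_has_least_nat[of "\<lambda>v. v \<in> pverts G" _ d] by blast
    have "d v = 0"
    proof (rule ccontr)
      assume "d v \<noteq> 0"
      then obtain u where u: "(u, v) \<in> P" using td_forestD(5)[OF F v(1)] by blast
      then show False using td_forestD(1)[OF F] td_forestD(3)[OF F u] v(2)[of u] by auto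
    qed
    then show thesis using that v(1) by blast
  qed
  have reach: "u \<rightarrow>\<^sup>*\<^bsub>with_proj T\<^esub> v" if "(u, v) \<in> P\<^sup>*" "u \<in> pverts G" for u v
    using that T.reachable_conv'[of u v] by simp
  have len: "d v = length p" if "T.awalk r p v" for p v
    using that
  proof (induction p arbitrary: v rule: rev_induct)
    case Nil
    then show ?case using r by (simp add: T.awalk_Nil_iff)
  next
    case (snoc e p)
    then obtain w where w: "T.awalk r p w" "T.awalk w [e] v" by auto
    then have "(w, v) \<in> P" by (auto simp: T.awalk_simps)
    then show ?case using td_forestD(3)[OF F] snoc.IH[OF w(1)] by simp
  qed
  \<comment> \<open>Both walks have length \<open>d v\<close>. Their last arcs agree by uniqueness
    of parents, and the induction compares the remaining prefixes.\<close>
  have unique: "p = q" if "T.awalk r p v" "T.awalk r q v" for p q v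
    using that
  proof (induction p arbitrary: q v rule: rev_induct)
    case Nil
    then show ?case using len[OF Nil(1)] len[OF Nil(2)] by simp
  next
    case (snoc e p)
    have "length q = length (p @ [e])" using len[OF snoc.prems(1)] len[OF snoc.prems(2)] by simp
    then obtain q' e' where q: "q = q' @ [e']" by (cases q rule: rev_cases) auto
    obtain w where w: "T.awalk r p w" "T.awalk w [e] v" using snoc.prems(1) by auto
    obtain w' where w': "T.awalk r q' w'" "T.awalk w' [e'] v" using snoc.prems(2) q by auto
    have e: "e = (w, v)" "(w, v) \<in> P" "e' = (w', v)" "(w', v) \<in> P"
      using w(2) w'(2) by (cases e; cases e'; simp add: T.awalk_simps)+
    then have "w = w'" using td_forestD(2)[OF F] by blast
    then show ?case using snoc.IH[OF w(1), of q'] w'(1) q e by simp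
  qed
  have tree: "rooted_tree T r"
    unfolding rooted_tree_def
  proof (intro conjI ballI)
    show "pair_wf_digraph T" by unfold_locales
    show "r \<in> pverts T" using r by simp
    fix v assume "v \<in> pverts T"
    then have "r \<rightarrow>\<^sup>*\<^bsub>with_proj T\<^esub> v"
      using td_forest_single_root[OF F conn sym r] reach r(1) by simp
    then show "\<exists>!p. T.awalk r p v" using unique T.reachable_awalk by blast
  qed
  have "u \<rightarrow>\<^sup>*\<^bsub>with_proj T\<^esub> v \<or> v \<rightarrow>\<^sup>*\<^bsub>with_proj T\<^esub> u" if "(u, v) \<in> parcs G" for u v
    using td_forestD(6)[OF F, of u v] reach[of u v] reach[of v u] G.wellformed'[OF that] that by blast
  then have "treedepth_decomposition G T r"
    unfolding treedepth_decomposition_def using tree by auto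
  then have "treedepth G \<le> height T r"
    unfolding treedepth_def by (blast intro: Least_le)
  also have "\<dots> \<le> k"
    unfolding height_def
  proof (rule Max.boundedI)
    show "finite {depth T r v |v. leaf T v}"
      using G.pair_finite_verts by (simp add: setcompr_eq_image leaf_def)
    show "{depth T r v |v. leaf T v} \<noteq> {}"
      using leaf_below[OF tree, of r] G.pair_finite_verts r(1) by auto
    show "n \<le> k" if n: "n \<in> {depth T r v |v. leaf T v}" for n
    proof -
      obtain v where v: "n = depth T r v" "v \<in> pverts G" using n by (auto simp: leaf_def)
      obtain p where p: "T.awalk r p v" "root_path T r v = set (pawalk_verts r p)"
        using rooted_tree_awalk[OF tree, of v] v(2) by auto
      have "n \<le> length (pawalk_verts r p)" unfolding v(1) depth_def p(2) by (rule card_length)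
      \<comment> \<open>\<open>d\<close> counts from 0 while \<open>depth\<close> counts vertices;
        the strict bound \<open>d v < k\<close> absorbs the difference.\<close>
      also have "\<dots> = Suc (d v)" using T.length_awalk_verts len[OF p(1)] by simp
      finally show "n \<le> k" using td_forestD(4)[OF F v(2)] by simp
    qed
  qed
  finally show ?thesis .
qed

theorem theorem6:
  fixes G T :: "'a pair_pre_digraph" and r :: 'a
  assumes "pair_graph G"
    and "Digraph_Component.connected (with_proj G)"
    and "cograph G"
    and "\<not> complete_digraph (card (pverts G)) (with_proj G)"
    and "optimal_treedepth_decomposition G T r"
  shows "card (top_separator T r) \<le> treewidth G"
proof -
  interpret G: pair_graph G by fact
  have sym: "sym (parcs G)" using G.arcs_symmetric by (auto intro: symI)
  have ne: "pverts G \<noteq> {}" using cut_connected_if_connected(1)[OF assms(2)] sym by simp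
  have T: "rooted_tree T r" and V: "pverts T = pverts G" and height: "height T r = treedepth G"
    using assms(5) unfolding optimal_treedepth_decomposition_def treedepth_decomposition_def by auto
  have fin: "finite (pverts T)" using V by simp
  obtain u v where uv: "u \<in> pverts G" "v \<in> pverts G" "u \<noteq> v" "(u, v) \<notin> parcs G"
  proof -
    \<comment> \<open>The vertex count in \<open>complete_digraph\<close> is the true one and there
      are no loops, so only a missing arc between distinct vertices can violate
      completeness.\<close>
    have "(w, w) \<notin> parcs G" for w using G.no_loops' by blast
    then show thesis
      using that assms(4) G.wellformed' unfolding complete_digraph_pair_def by auto
  qed
  have "treedepth G \<le> card (pverts G) - 1"
    using td_le_not_complete[OF _ uv sym] treedepth_le[OF assms(1,2)] by simp
  \<comment> \<open>Positivity makes \<open>card (pverts G) - 1\<close> strictly smaller than the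
    height of an unbranched tree.\<close>
  moreover have "card (pverts G) > 0" using ne by (simp add: card_gt_0_iff)
  ultimately have "\<not> (\<forall>v \<in> pverts T. card (children T v) \<le> 1)"
    using unbranched_height[OF T fin] V height by force
  then have "card (top_separator T r) < treedepth G"
    using top_separator_lt_height[OF T fin] height by simp
  moreover obtain k F where "td_le (parcs G) (pverts G) k"
    "bramble (parcs G) (pverts G) F" "order_ge (pverts G) F k"
    using cograph_duality[OF _ ne sym P4_free_if_cograph[OF assms(1,3)]] by auto
  then have "treedepth G \<le> treewidth G + 1"
    using treedepth_le[OF assms(1,2)] treewidth_ge_bramble_order[OF assms(1)] by (meson le_trans)
  ultimately show ?thesis by simp
qed

end
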